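(* For every $n\ge 2$, the minimum possible co-dimension (in $\mathbb{Z}_2^{\binom n2}$) of a linear space $\mathcal{L}$ of graphs on the vertex set $[n]$ such that $\mathcal{L}$ contains no clique is exactly $\lfloor n/2\rfloor$.
   Context: Graphs on $[n]=\{1,\dots,n\}$ are identified with their edge sets, i.e. with vectors in $\mathbb{Z}_2^{\binom n2}$ indexed by pairs of vertices; addition is symmetric difference of edge sets. A linear space of graphs is a family of graphs on $[n]$ closed under symmetric difference (a linear subspace of $\mathbb{Z}_2^{\binom n2}$). A clique here means a graph on $[n]$ whose edge set is the set of all pairs within some subset $A\subseteq[n]$ with $|A|\ge 2$. *)

theory Defs
  imports Complex_Main "HOL-Library.Z2" "HOL-Library.Function_Algebras"
begin

text \<open>
  Graphs are represented by vectors over the two-element field \<^typ>\<open>bit\<close> that are indexed by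
  sets of natural numbers; only coordinates that are two-element subsets of the vertex set
  may be nonzero. Addition of such functions is pointwise, i.e. symmetric difference of edge sets.
\<close>

type_synonym graph = "nat set \<Rightarrow> bit"

definition pairs :: "nat set \<Rightarrow> nat set set" where
  "pairs A = {e. e \<subseteq> A \<and> card e = 2}"

definition graph_of :: "nat set set \<Rightarrow> graph" where
  "graph_of E = (\<lambda>e. of_bool (e \<in> E))"

lemma graph_of_plus: "graph_of E + graph_of F = graph_of ((E - F) \<union> (F - E))"
  by (auto simp: graph_of_def fun_eq_iff)

definition graphs_on :: "nat \<Rightarrow> graph set" where
  "graphs_on n = {g. \<forall>e. e \<notin> pairs {1..n} \<longrightarrow> g e = 0}"

definition scale_graph :: "bit \<Rightarrow> graph \<Rightarrow> graph" where
  "scale_graph c g = (\<lambda>e. c * g e)"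

interpretation graph_space: vector_space scale_graph
  by unfold_locales (auto simp: scale_graph_def fun_eq_iff algebra_simps)

definition linear_space_of_graphs :: "nat \<Rightarrow> graph set \<Rightarrow> bool" where
  "linear_space_of_graphs n L \<longleftrightarrow> graph_space.subspace L \<and> L \<subseteq> graphs_on n"

lemma finite_pairs: "finite (pairs {1..n})"
  unfolding pairs_def by (rule finite_subset[of _ "Pow {1..n}"]) auto

lemma sum_graph_apply: "(\<Sum>x\<in>S. h x :: graph) e = (\<Sum>x\<in>S. h x e)"
  by (induction S rule: infinite_finite_induct) auto

lemma dim_graphs_on: "graph_space.dim (graphs_on n) = n choose 2"
proof -
  let ?s = "\<lambda>e. graph_of {e}"
  let ?B = "?s ` pairs {1..n}"
  have inj: "inj_on ?s (pairs {1..n})"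
    by (auto simp: inj_on_def graph_of_def fun_eq_iff of_bool_def split: if_splits)
  have sub: "?B \<subseteq> graphs_on n"
    by (auto simp: graphs_on_def graph_of_def)
  have expand: "(\<Sum>e\<in>pairs {1..n}. scale_graph (c e) (?s e)) a = (if a \<in> pairs {1..n} then c a else 0)"
    for c a
  proof -
    have "c e * of_bool (a \<in> {e}) = (if a = e then c e else 0)" for e
      by simp
    then show ?thesis
      unfolding sum_graph_apply scale_graph_def graph_of_def
      by (simp only: sum.delta' finite_pairs)
  qed
  have span: "graphs_on n \<subseteq> graph_space.span ?B"
  proof
    fix g assume "g \<in> graphs_on n"
    then have "g = (\<Sum>e\<in>pairs {1..n}. scale_graph (g e) (?s e))"
      unfolding fun_eq_iff expand by (auto simp: graphs_on_def)
    also have "\<dots> \<in> graph_space.span ?B"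
      by (intro graph_space.span_sum graph_space.span_scale graph_space.span_base) auto
    finally show "g \<in> graph_space.span ?B" .
  qed
  have indep: "graph_space.independent ?B"
  proof (rule graph_space.independent_if_scalars_zero)
    show "finite ?B" by (intro finite_imageI finite_pairs)
    fix f x assume z: "(\<Sum>x\<in>?B. scale_graph (f x) x) = 0" and "x \<in> ?B"
    then obtain a where a: "a \<in> pairs {1..n}" "x = ?s a" by auto
    have "(\<Sum>e\<in>pairs {1..n}. scale_graph (f (?s e)) (?s e)) a = 0"
      using z unfolding sum.reindex[OF inj] o_def by simp
    then show "f x = 0" using a unfolding expand by (simp del: One_nat_def)
  qed
  have "card (pairs {1..n}) = n choose 2"
    using n_subsets[of "{1..n}" 2] by (simp add: pairs_def)
  then show ?thesis
    using graph_space.dim_unique[OF sub span indep] card_image[OF inj] by simp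
qed

text \<open>
  The truncated subtraction below is harmless: the ambient space is finite-dimensional and
  contains every linear space of graphs.
\<close>

definition codim :: "nat \<Rightarrow> graph set \<Rightarrow> nat" where
  "codim n L = graph_space.dim (graphs_on n) - graph_space.dim L"

definition is_clique :: "nat \<Rightarrow> graph \<Rightarrow> bool" where
  "is_clique n g \<longleftrightarrow> (\<exists>A. A \<subseteq> {1..n} \<and> card A \<ge> 2 \<and> g = graph_of (pairs A))"

definition clique_free_space :: "nat \<Rightarrow> graph set \<Rightarrow> bool" where
  "clique_free_space n L \<longleftrightarrow> linear_space_of_graphs n L \<and> (\<forall>g\<in>L. \<not> is_clique n g)"

end

theory Submission
  imports Defs
begin

text \<open>
  Lower bound: a space of co-dimension k is the common kernel of k functionals, and the value of
  such a functional on the clique on A is a quadratic polynomial in the indicator vector of A.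
  If there is no clique in the kernel, the product of the k polynomials 1 + q is the indicator of
  the sets A with at most one element. Summed over all subsets A of an even vertex set it gives 1,
  whereas, as in the Chevalley--Warning theorem, a polynomial of degree 2k sums to 0 as soon as
  there are more than 2k vertices.

  Upper bound: colour every pair by half of its larger element, rounded down, and let the space
  consist of the graphs with an even number of edges of each colour. If v is the second smallest
  vertex of A, then the clique on A has one or three edges of the colour of v.
\<close>

section \<open>Finiteness and linear structure of the graph space\<close>

lemma finite_graphs_on: "finite (graphs_on n)"
proof (rule finite_subset)
  show "graphs_on n \<subseteq> graph_of ` Pow (pairs {1..n})"
  proof
    fix g assume g: "g \<in> graphs_on n"
    have "g = graph_of {e \<in> pairs {1..n}. g e = 1}"
    proof
      fix e show "g e = graph_of {e \<in> pairs {1..n}. g e = 1} e"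
        using g by (cases "g e") (auto simp: graph_of_def graphs_on_def)
    qed
    then show "g \<in> graph_of ` Pow (pairs {1..n})" by blast
  qed
  show "finite (graph_of ` Pow (pairs {1..n}))"
    by (intro finite_imageI finite_Pow_iff[THEN iffD2] finite_pairs)
qed

lemma subspace_graphs_on: "graph_space.subspace (graphs_on n)"
  by (auto simp: graph_space.subspace_def graphs_on_def scale_graph_def)

lemma graph_of_in_graphs_on: "E \<subseteq> pairs {1..n} \<Longrightarrow> graph_of E \<in> graphs_on n"
  by (auto simp: graphs_on_def graph_of_def)

lemma graph_of_eq_sum:
  assumes "finite E"
  shows "graph_of E = (\<Sum>e\<in>E. graph_of {e})"
proof
  fix a
  have "(\<Sum>e\<in>E. graph_of {e}) a = (\<Sum>e\<in>E. if a = e then 1 else 0)"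
    unfolding sum_graph_apply by (intro sum.cong) (auto simp: graph_of_def)
  then show "graph_of E a = (\<Sum>e\<in>E. graph_of {e}) a"
    using assms by (simp add: graph_of_def of_bool_def)
qed

section \<open>A Chevalley--Warning argument for quadratic polynomials over
  \<open>bit\<close>\<close>

text \<open>The induction on \<open>C\<close> needs all supersets of a given \<open>T\<close>, not
  only the case \<open>T = {}\<close>. Multiplying out one factor replaces \<open>T\<close> by
  \<open>T \<union> e\<close> for pairs \<open>e\<close>: \<open>card T\<close> grows by at most 2
  while \<open>2 * card C\<close> drops by 2, so the bound persists. With no factor left, the number
  of sets between \<open>T\<close> and \<open>M\<close> is 2 to a positive exponent, hence
  even.\<close>

lemma sum_supersets_prod_quadratic_eq_0:
  fixes w :: "'c \<Rightarrow> 'a set \<Rightarrow> bit"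
  assumes "finite M" "finite C" "T \<subseteq> M" "card T + 2 * card C < card M"
    and P: "\<And>e. e \<in> P \<Longrightarrow> e \<subseteq> M \<and> card e = 2"
  shows "(\<Sum>A | T \<subseteq> A \<and> A \<subseteq> M. \<Prod>c\<in>C. 1 + (\<Sum>e\<in>P. if e \<subseteq> A then w c e else 0)) = 0"
  using assms(2,3,4)
proof (induction C arbitrary: T rule: finite_induct)
  case empty
  have "{A. T \<subseteq> A \<and> A \<subseteq> M} = (\<lambda>B. T \<union> B) ` Pow (M - T)"
  proof (intro equalityI subsetI)
    fix A assume "A \<in> {A. T \<subseteq> A \<and> A \<subseteq> M}"
    then have "A = T \<union> (A - T)" "A - T \<in> Pow (M - T)" by auto
    then show "A \<in> (\<lambda>B. T \<union> B) ` Pow (M - T)" by blast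
  qed (use empty in auto)
  moreover have "inj_on (\<lambda>B. T \<union> B) (Pow (M - T))"
    by (auto simp: inj_on_def)
  ultimately have "card {A. T \<subseteq> A \<and> A \<subseteq> M} = 2 ^ card (M - T)"
    using \<open>finite M\<close> by (simp add: card_image card_Pow)
  moreover have "card (M - T) \<noteq> 0"
    using empty \<open>finite M\<close> by (simp add: card_Diff_subset finite_subset)
  ultimately have "even (card {A. T \<subseteq> A \<and> A \<subseteq> M})" by simp
  then show ?case by (auto elim!: evenE)
next
  case (insert c C)
  let ?R = "\<lambda>A. \<Prod>c\<in>C. 1 + (\<Sum>e\<in>P. if e \<subseteq> A then w c e else 0)"
  let ?U = "\<lambda>T. {A. T \<subseteq> A \<and> A \<subseteq> M}"
  have fin: "finite (?U T)" for T
    by (rule finite_subset[of _ "Pow M"]) (use \<open>finite M\<close> in auto)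
  \<comment> \<open>The monomial of \<open>e\<close> can be nonzero only on sets containing
    \<open>e\<close>, so the sum shrinks to the supersets of \<open>T \<union> e\<close>.\<close>
  have step: "(\<Sum>A\<in>?U T. (if e \<subseteq> A then w c e else 0) * ?R A) = 0" if "e \<in> P" for e
  proof -
    have "(\<Sum>A\<in>?U T. (if e \<subseteq> A then w c e else 0) * ?R A)
        = (\<Sum>A\<in>?U (T \<union> e). w c e * ?R A)"
      by (rule sum.mono_neutral_cong_right) (use fin in auto)
    also have "\<dots> = w c e * (\<Sum>A\<in>?U (T \<union> e). ?R A)"
      by (rule sum_distrib_left[symmetric])
    also have "(\<Sum>A\<in>?U (T \<union> e). ?R A) = 0"
    proof (rule insert.IH)
      show "T \<union> e \<subseteq> M" using insert.prems P[OF that] by auto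
      show "card (T \<union> e) + 2 * card C < card M"
        using insert.prems insert.hyps P[OF that] card_Un_le[of T e] by simp
    qed
    finally show ?thesis by simp
  qed
  have "(\<Sum>A\<in>?U T. \<Prod>c\<in>insert c C. 1 + (\<Sum>e\<in>P. if e \<subseteq> A then w c e else 0))
      = (\<Sum>A\<in>?U T. ?R A + (\<Sum>e\<in>P. (if e \<subseteq> A then w c e else 0) * ?R A))"
    by (simp only: prod.insert[OF insert.hyps] distrib_right sum_distrib_right mult_1)
  also have "\<dots> = (\<Sum>A\<in>?U T. ?R A)
      + (\<Sum>e\<in>P. \<Sum>A\<in>?U T. (if e \<subseteq> A then w c e else 0) * ?R A)"
    unfolding sum.distrib by (subst sum.swap) (rule refl)
  also have "(\<Sum>e\<in>P. \<Sum>A\<in>?U T. (if e \<subseteq> A then w c e else 0) * ?R A) = 0"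
    by (rule sum.neutral) (use step in blast)
  also have "(\<Sum>A\<in>?U T. ?R A) = 0"
    by (rule insert.IH) (use insert.prems insert.hyps in auto)
  finally show ?case by simp
qed

text \<open>Otherwise every \<open>A\<close> with at least two elements has a polynomial q of value
  1, so its factor 1 + q is 0, while smaller sets give the product 1. Summing over all
  \<open>A\<close> counts the \<open>card M + 1\<close> sets with at most one element. This number
  is odd because \<open>card M\<close> is even, yet the sum vanishes by the degree bound.\<close>

lemma quadratics_vanish_on_large_set:
  fixes w :: "'c \<Rightarrow> 'a set \<Rightarrow> bit"
  assumes "finite M" "finite C" "even (card M)" "2 * card C < card M"
  obtains A where "A \<subseteq> M" "2 \<le> card A"
    "\<And>c. c \<in> C \<Longrightarrow> (\<Sum>e | e \<subseteq> A \<and> card e = 2. w c e) = 0"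
proof (rule ccontr)
  assume "\<not> thesis"
  with that have odd: "\<exists>c\<in>C. (\<Sum>e | e \<subseteq> A \<and> card e = 2. w c e) \<noteq> 0"
    if "A \<subseteq> M" "2 \<le> card A" for A
    using \<open>A \<subseteq> M\<close> \<open>2 \<le> card A\<close> by blast
  let ?P = "{e. e \<subseteq> M \<and> card e = 2}"
  let ?R = "\<lambda>A. \<Prod>c\<in>C. 1 + (\<Sum>e\<in>?P. if e \<subseteq> A then w c e else 0)"
  let ?Q = "insert {} ((\<lambda>x. {x}) ` M)"
  have finP: "finite ?P"
    by (rule finite_subset[of _ "Pow M"]) (use \<open>finite M\<close> in auto)
  \<comment> \<open>The index set \<open>?P\<close> must not depend on \<open>A\<close> if the sum
    is to be a polynomial in \<open>A\<close>; on subsets of \<open>M\<close> it gives the sum over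
    the pairs inside \<open>A\<close>.\<close>
  have q: "(\<Sum>e\<in>?P. if e \<subseteq> A then w c e else 0) = (\<Sum>e | e \<subseteq> A \<and> card e = 2. w c e)"
    if "A \<subseteq> M" for A c
    by (rule sum.mono_neutral_cong_right) (use that finP in auto)
  have small: "A \<in> ?Q \<longleftrightarrow> card A < 2" if "A \<subseteq> M" for A
  proof -
    have "finite A" using that \<open>finite M\<close> finite_subset by blast
    then have "card A < 2 \<longleftrightarrow> A = {} \<or> (\<exists>x. A = {x})"
      by (metis One_nat_def card_1_singletonE card_eq_0_iff is_singletonI is_singleton_altdef
          less_2_cases_iff)
    then show ?thesis using that by auto
  qed
  have R: "?R A = (if A \<in> ?Q then 1 else 0)" if "A \<subseteq> M" for A
  proof (cases "card A < 2")
    case True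
    have "finite A" using that \<open>finite M\<close> finite_subset by blast
    then have "card e \<noteq> 2" if "e \<subseteq> A" for e
      using True card_mono[OF _ that] by linarith
    then have none: "{e. e \<subseteq> A \<and> card e = 2} = {}" by blast
    have "?R A = 1"
      by (rule prod.neutral) (simp only: q[OF that] none sum.empty add_0_right simp_thms ball_triv)
    then show ?thesis by (simp only: small[OF that] True if_True)
  next
    case False
    then have "2 \<le> card A" by simp
    from odd[OF that this] obtain c
      where c: "c \<in> C" "(\<Sum>e | e \<subseteq> A \<and> card e = 2. w c e) \<noteq> 0" by blast
    have "?R A = 0"
    proof (rule prod_zero[OF \<open>finite C\<close>], rule bexI[OF _ c(1)])
      show "1 + (\<Sum>e\<in>?P. if e \<subseteq> A then w c e else 0) = 0"
        using c(2) unfolding q[OF that] by simp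
    qed
    then show ?thesis by (simp only: small[OF that] False if_False)
  qed
  have "(\<Sum>A | {} \<subseteq> A \<and> A \<subseteq> M. ?R A) = (\<Sum>A\<in>?Q. 1)"
  proof (rule sum.mono_neutral_cong_right)
    show "finite {A. {} \<subseteq> A \<and> A \<subseteq> M}"
      by (rule finite_subset[of _ "Pow M"]) (use \<open>finite M\<close> in auto)
    show sub: "?Q \<subseteq> {A. {} \<subseteq> A \<and> A \<subseteq> M}" by auto
    show "\<forall>A\<in>{A. {} \<subseteq> A \<and> A \<subseteq> M} - ?Q. ?R A = 0"
    proof
      fix A assume "A \<in> {A. {} \<subseteq> A \<and> A \<subseteq> M} - ?Q"
      then have "A \<subseteq> M" "A \<notin> ?Q" by blast+
      then show "?R A = 0" by (simp only: R if_False)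
    qed
    show "?R A = 1" if "A \<in> ?Q" for A
    proof -
      have "A \<subseteq> M" using sub that by blast
      with that show ?thesis by (simp only: R if_True)
    qed
  qed
  also have "\<dots> = of_nat (card ?Q)" by simp
  also have "card ?Q = Suc (card M)"
    using \<open>finite M\<close> by (subst card_insert_disjoint) (auto simp: card_image)
  also have "of_nat (Suc (card M)) = (1::bit)"
    using \<open>even (card M)\<close> by (auto elim!: evenE)
  finally have "(\<Sum>A | {} \<subseteq> A \<and> A \<subseteq> M. ?R A) = 1" .
  moreover have "(\<Sum>A | {} \<subseteq> A \<and> A \<subseteq> M. ?R A) = 0"
    by (rule sum_supersets_prod_quadratic_eq_0) (use assms finP in auto)
  ultimately show False by (simp only: zero_neq_one)
qed

section \<open>Lower bound on the co-dimension\<close>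

text \<open>Extend a basis \<open>B\<close> of \<open>L\<close> to a basis \<open>D\<close> of all
  graphs. The functionals are the coordinates belonging to \<open>D - B\<close>: a graph on which
  they all vanish is a combination of vectors of \<open>B\<close>.\<close>

lemma subspace_kernel_of_functionals:
  assumes "linear_space_of_graphs n L"
  obtains C and w :: "graph \<Rightarrow> nat set \<Rightarrow> bit"
  where "finite C" "card C = codim n L"
    "\<And>E. E \<subseteq> pairs {1..n} \<Longrightarrow> (\<And>c. c \<in> C \<Longrightarrow> (\<Sum>e\<in>E. w c e) = 0) \<Longrightarrow> graph_of E \<in> L"
proof -
  have L: "graph_space.subspace L" "L \<subseteq> graphs_on n"
    using assms by (auto simp: linear_space_of_graphs_def)
  obtain B where B: "B \<subseteq> L" "graph_space.independent B" "L \<subseteq> graph_space.span B"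
      "card B = graph_space.dim L"
    using graph_space.basis_exists by blast
  obtain D where D: "B \<subseteq> D" "D \<subseteq> graphs_on n" "graph_space.independent D"
      "graphs_on n \<subseteq> graph_space.span D"
    using graph_space.maximal_independent_subset_extend[of B "graphs_on n"] B L by blast
  have finD: "finite D" using D finite_graphs_on finite_subset by blast
  \<comment> \<open>By linearity a coordinate functional is determined by its values on single
    edges.\<close>
  define w where "w = (\<lambda>c e. graph_space.representation D (graph_of {e}) c)"
  show thesis
  proof
    show "finite (D - B)" using finD by simp
    have "card D = graph_space.dim (graphs_on n)"
      using graph_space.dim_unique[OF D(2,4,3)] by simp
    then show "card (D - B) = codim n L"
      using B(4) finD D(1) by (simp add: codim_def card_Diff_subset finite_subset)
    fix E assume E: "E \<subseteq> pairs {1..n}" and z: "\<And>c. c \<in> D - B \<Longrightarrow> (\<Sum>e\<in>E. w c e) = 0"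
    have finE: "finite E" using E finite_pairs finite_subset by blast
    have inD: "graph_of F \<in> graph_space.span D" if "F \<subseteq> pairs {1..n}" for F
      using graph_of_in_graphs_on[OF that] D by blast
    let ?r = "graph_space.representation D (graph_of E)"
    have "?r c = (\<Sum>e\<in>E. w c e)" for c
      unfolding graph_of_eq_sum[OF finE] w_def
      by (subst graph_space.representation_sum[OF D(3)]) (use E inD in auto)
    then have z': "?r c = 0" if "c \<in> D - B" for c
      using z[OF that] by simp
    have "graph_of E = (\<Sum>c\<in>D. scale_graph (?r c) c)"
      using graph_space.sum_representation_eq[OF D(3) inD[OF E] finD subset_refl] by simp
    also have "\<dots> \<in> L"
    proof (rule graph_space.subspace_sum[OF L(1)])
      fix c assume "c \<in> D"
      then show "scale_graph (?r c) c \<in> L"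
        using z'[of c] B(1) L(1)
        by (cases "c \<in> B")
          (auto simp: graph_space.subspace_0 intro: graph_space.subspace_scale)
    qed
    finally show "graph_of E \<in> L" .
  qed
qed

lemma codim_clique_free_ge:
  assumes "clique_free_space n L"
  shows "n div 2 \<le> codim n L"
proof (rule ccontr)
  assume less: "\<not> n div 2 \<le> codim n L"
  have "linear_space_of_graphs n L"
    using assms by (simp add: clique_free_space_def)
  then obtain C and w :: "graph \<Rightarrow> nat set \<Rightarrow> bit" where C: "finite C" "card C = codim n L"
    and ker: "\<And>E. E \<subseteq> pairs {1..n} \<Longrightarrow> (\<And>c. c \<in> C \<Longrightarrow> (\<Sum>e\<in>E. w c e) = 0) \<Longrightarrow> graph_of E \<in> L"
    by (rule subspace_kernel_of_functionals) blast
  \<comment> \<open>For odd \<open>n\<close> the last vertex is dropped, which makes the vertex set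
    even while its size still exceeds \<open>2 * card C\<close>.\<close>
  let ?M = "{1..2 * (n div 2)}"
  obtain A where A: "A \<subseteq> ?M" "2 \<le> card A"
    "\<And>c. c \<in> C \<Longrightarrow> (\<Sum>e | e \<subseteq> A \<and> card e = 2. w c e) = 0"
    using quadratics_vanish_on_large_set[of ?M C w] C less by auto
  have "A \<subseteq> {1..n}" using A(1) by fastforce
  moreover from this have "pairs A \<subseteq> pairs {1..n}" by (auto simp: pairs_def)
  then have "graph_of (pairs A) \<in> L"
    by (rule ker) (use A(3) in \<open>auto simp: pairs_def\<close>)
  ultimately show False
    using assms A(2) by (auto simp: clique_free_space_def is_clique_def)
qed

section \<open>Parity of the colour classes on a clique\<close>

lemma odd_card_pairs_of_colour:
  fixes A :: "nat set"
  assumes "finite A" "2 \<le> card A" "A \<subseteq> {1..n}"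
  obtains i where "i \<in> {1..n div 2}" "odd (card {e \<in> pairs A. Max e div 2 = i})"
proof -
  define u where "u = Min A"
  define v where "v = Min (A - {u})"
  have "A \<noteq> {}" using assms by auto
  then have u: "u \<in> A" "\<And>x. x \<in> A \<Longrightarrow> u \<le> x"
    using assms by (auto simp: u_def)
  have "card (A - {u}) \<noteq> 0" using assms u by simp
  then have ne: "A - {u} \<noteq> {}" by force
  then have "v \<in> A - {u}" unfolding v_def using assms(1) by (intro Min_in) auto
  then have v: "v \<in> A" "u < v" using u(2)[of v] by auto
  have v_le: "v \<le> x" if "x \<in> A" "x \<noteq> u" for x
    using that assms(1) unfolding v_def by (intro Min_le) auto
  let ?S = "{e \<in> pairs A. Max e div 2 = v div 2}"
  \<comment> \<open>Vertices of the colour of \<open>v\<close> other than \<open>v\<close> itself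
    are \<open>Suc v\<close> for even \<open>v\<close>, or \<open>v - 1\<close> for odd
    \<open>v\<close>. In the odd case no pair ends in \<open>v - 1\<close>, since \<open>u\<close>
    is the only element of \<open>A\<close> below \<open>v\<close>.\<close>
  let ?T = "if even v \<and> Suc v \<in> A then {{u, v}, {u, Suc v}, {v, Suc v}} else {{u, v}}"
  have "e \<in> ?T" if "e \<in> ?S" for e
  proof -
    obtain x y where e: "e = {x, y}" "x < y" "x \<in> A" "y \<in> A"
    proof -
      obtain x y where "e = {x, y}" "x \<noteq> y" "x \<in> A" "y \<in> A"
        using \<open>e \<in> ?S\<close> unfolding pairs_def card_2_iff by blast
      then show ?thesis using that[of x y] that[of y x] by (cases "x < y") auto
    qed
    have col: "y div 2 = v div 2" using that e by simp
    have "v \<le> y" using v_le[of y] u(2)[of x] e by auto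
    with col have "y = v \<or> y = Suc v \<and> even v" by presburger
    then consider "y = v" | "y = Suc v" "even v" by blast
    then show ?thesis
    proof cases
      case 1
      then have "x = u" using v_le[of x] e by force
      then show ?thesis using 1 e by simp
    next
      case 2
      then have "x = u \<or> x = v" using v_le[of x] e by force
      then show ?thesis using 2 e by auto
    qed
  qed
  moreover have "?T \<subseteq> ?S"
    using u v by (auto simp: pairs_def)
  ultimately have "?S = ?T" by blast
  moreover have "odd (card ?T)"
  proof -
    have "{u, v} \<noteq> {u, Suc v}" "{u, v} \<noteq> {v, Suc v}" "{u, Suc v} \<noteq> {v, Suc v}"
      using v(2) by (auto simp: doubleton_eq_iff)
    then show ?thesis by simp
  qed
  moreover have "v div 2 \<in> {1..n div 2}"
  proof -
    \<comment> \<open>Vertices start at 1, so \<open>v\<close> is at least 2 and its colour is not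
      0.\<close>
    have "1 \<le> u" "v \<le> n" using u(1) v(1) assms(3) by auto
    then show ?thesis using v(2) div_le_mono[of v n 2] div_le_mono[of 2 v 2] by simp
  qed
  ultimately show thesis using that[of "v div 2"] by simp
qed

section \<open>Upper bound by the space of graphs with even colour classes\<close>

definition colour_sum :: "nat \<Rightarrow> nat \<Rightarrow> graph \<Rightarrow> bit" where
  "colour_sum n i g = (\<Sum>e | e \<in> pairs {1..n} \<and> Max e div 2 = i. g e)"

text \<open>A common kernel of \<open>n div 2\<close> functionals. Colour 0 does not occur, as the
  larger element of a pair in \<open>{1..n}\<close> is at least 2.\<close>

definition even_colours_space :: "nat \<Rightarrow> graph set" where
  "even_colours_space n = {g \<in> graphs_on n. \<forall>i\<in>{1..n div 2}. colour_sum n i g = 0}"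

lemma colour_sum_add: "colour_sum n i (g + h) = colour_sum n i g + colour_sum n i h"
  unfolding colour_sum_def plus_fun_apply by (rule sum.distrib)

lemma colour_sum_scale: "colour_sum n i (scale_graph c g) = c * colour_sum n i g"
  unfolding colour_sum_def scale_graph_def by (rule sum_distrib_left[symmetric])

lemma colour_sum_sum: "colour_sum n i (\<Sum>x\<in>S. h x) = (\<Sum>x\<in>S. colour_sum n i (h x))"
  unfolding colour_sum_def sum_graph_apply by (rule sum.swap)

lemma colour_sum_graph_of:
  assumes "E \<subseteq> pairs {1..n}"
  shows "colour_sum n i (graph_of E) = of_nat (card {e \<in> E. Max e div 2 = i})"
proof -
  have "finite {e. e \<in> pairs {1..n} \<and> Max e div 2 = i}"
    by (rule finite_subset[OF _ finite_pairs]) auto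
  then have "colour_sum n i (graph_of E) = (\<Sum>e | e \<in> E \<and> Max e div 2 = i. 1)"
    unfolding colour_sum_def
    by (intro sum.mono_neutral_cong_right) (use assms in \<open>auto simp: graph_of_def\<close>)
  then show ?thesis by simp
qed

lemma linear_even_colours_space: "linear_space_of_graphs n (even_colours_space n)"
proof -
  have "colour_sum n i 0 = 0" for i
    by (simp add: colour_sum_def)
  then have "graph_space.subspace (even_colours_space n)"
    using subspace_graphs_on[of n] unfolding graph_space.subspace_def even_colours_space_def
    by (simp add: colour_sum_add colour_sum_scale)
  then show ?thesis
    by (auto simp: linear_space_of_graphs_def even_colours_space_def)
qed

lemma clique_free_even_colours_space: "clique_free_space n (even_colours_space n)"
  unfolding clique_free_space_def
proof (intro conjI ballI notI linear_even_colours_space)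
  fix g assume g: "g \<in> even_colours_space n" and "is_clique n g"
  then obtain A where A: "A \<subseteq> {1..n}" "2 \<le> card A" "g = graph_of (pairs A)"
    by (auto simp: is_clique_def)
  obtain i where i: "i \<in> {1..n div 2}" "odd (card {e \<in> pairs A. Max e div 2 = i})"
    using odd_card_pairs_of_colour[of A n] A finite_subset by blast
  have "pairs A \<subseteq> pairs {1..n}" using A(1) by (auto simp: pairs_def)
  then have "colour_sum n i g = 1"
    using i(2) unfolding A(3) by (auto simp: colour_sum_graph_of elim!: oddE)
  then show False using g i(1) by (simp add: even_colours_space_def)
qed

text \<open>The one-edge graphs on \<open>{1, 2 * i}\<close> are dual to the colour sums, so
  together with a basis of the kernel they span all graphs.\<close>

lemma codim_even_colours_space_le: "codim n (even_colours_space n) \<le> n div 2"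
proof -
  let ?L = "even_colours_space n"
  let ?s = "\<lambda>i. graph_of {{1, 2 * i}}"
  let ?S = "?s ` {1..n div 2}"
  obtain B where B: "B \<subseteq> ?L" "graph_space.independent B" "?L \<subseteq> graph_space.span B"
      "card B = graph_space.dim ?L"
    using graph_space.basis_exists by blast
  have finB: "finite B"
    using B(1) finite_graphs_on by (auto simp: even_colours_space_def intro: finite_subset)
  have s: "?s i \<in> graphs_on n" "colour_sum n j (?s i) = (if j = i then 1 else 0)"
    if "i \<in> {1..n div 2}" for i j
  proof -
    have "{{1, 2 * i}} \<subseteq> pairs {1..n}" using that by (auto simp: pairs_def)
    moreover have "{e \<in> {{1, 2 * i}}. Max e div 2 = j} = (if j = i then {{1, 2 * i}} else {})"
      using that by auto
    ultimately show "?s i \<in> graphs_on n" "colour_sum n j (?s i) = (if j = i then 1 else 0)"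
      by (simp_all add: graph_of_in_graphs_on colour_sum_graph_of del: One_nat_def)
  qed
  have "graphs_on n \<subseteq> graph_space.span (B \<union> ?S)"
  proof
    fix g assume g: "g \<in> graphs_on n"
    \<comment> \<open>\<open>?h\<close> has the same colour sums as \<open>g\<close>, so in
      characteristic 2 adding it to \<open>g\<close> cancels them all.\<close>
    let ?h = "\<Sum>i\<in>{1..n div 2}. scale_graph (colour_sum n i g) (?s i)"
    have "colour_sum n j (g + ?h) = 0" if "j \<in> {1..n div 2}" for j
    proof -
      have "colour_sum n j ?h = (\<Sum>i\<in>{1..n div 2}. if j = i then colour_sum n i g else 0)"
        unfolding colour_sum_sum colour_sum_scale
        by (rule sum.cong[OF refl]) (simp only: s(2) split: if_split, simp)
      then show ?thesis using that by (simp add: colour_sum_add)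
    qed
    moreover have "?h \<in> graphs_on n"
      by (intro graph_space.subspace_sum graph_space.subspace_scale subspace_graphs_on s)
    ultimately have "g + ?h \<in> ?L"
      using g graph_space.subspace_add[OF subspace_graphs_on] by (simp add: even_colours_space_def)
    then have "g + ?h \<in> graph_space.span (B \<union> ?S)"
      using B(3) graph_space.span_mono[of B "B \<union> ?S"] by blast
    moreover have "?h \<in> graph_space.span (B \<union> ?S)"
      by (intro graph_space.span_sum graph_space.span_scale graph_space.span_base) auto
    ultimately have "g + ?h - ?h \<in> graph_space.span (B \<union> ?S)"
      by (rule graph_space.span_diff)
    then show "g \<in> graph_space.span (B \<union> ?S)" by simp
  qed
  then have "graph_space.dim (graphs_on n) \<le> card (B \<union> ?S)"
    by (rule graph_space.dim_le_card) (use finB in simp)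
  also have "\<dots> \<le> card B + card ?S" by (rule card_Un_le)
  also have "card ?S \<le> n div 2"
    using card_image_le[of "{1..n div 2}" ?s] by simp
  finally show ?thesis using B(4) by (simp add: codim_def)
qed

theorem theorem1p6:
  fixes n :: nat
  assumes "n \<ge> 2"
  shows "(\<exists>L. clique_free_space n L \<and> codim n L = n div 2)
       \<and> (\<forall>L. clique_free_space n L \<longrightarrow> n div 2 \<le> codim n L)"
  using clique_free_even_colours_space codim_even_colours_space_le codim_clique_free_ge
  by (meson le_antisym)

end
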